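(* There exist a finite Markov decision process $(\mathcal S,\mathcal A,p,r,\hat{\boldsymbol p})$ with horizon $T=1$ and a single action, $\mathcal A=\{a_1\}$, and $\alpha\in(0,1]$ such that $$\mathrm{EVaR}_\alpha\big[r(\tilde s,a_1,\tilde s')\big]\;<\;\min_{\boldsymbol\xi\in\mathcal Z_{\mathrm E}}\ \sum_{s\in\mathcal S}\xi_s\,\mathrm{EVaR}_{\alpha\xi_s\hat p_s^{-1}}\big[r(s,a_1,\tilde s')\mid\tilde s=s\big],$$ where $$\mathcal Z_{\mathrm E}=\Big\{\boldsymbol\xi\in\Delta_S\ \Big|\ \sum_{s\in\mathcal S}\xi_s\log(\xi_s/\hat p_s)\le-\log\alpha,\quad \alpha\,\xi_s\le\hat p_s\ \text{for all } s\in\mathcal S\Big\}.$$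
   Context: A finite MDP with horizon $T=1$ consists of a finite state set $\mathcal S$ with $S=|\mathcal S|$, a finite action set $\mathcal A$, a transition function $p$ where $p(s,a,\cdot)$ is a probability distribution on $\mathcal S$ for each $(s,a)$, a reward function $r:\mathcal S\times\mathcal A\times\mathcal S\to\mathbb R$, and an initial distribution $\hat{\boldsymbol p}$ on $\mathcal S$ with $\hat p_s>0$ for every $s\in\mathcal S$. $\Delta_S$ is the set of probability vectors indexed by $\mathcal S$. Here $\tilde s\sim\hat{\boldsymbol p}$ and $\tilde s'\sim p(\tilde s,a_1,\cdot)$ given $\tilde s$. A risk measure written with "$\mid\tilde s=s$" is evaluated under the conditional distribution given $\tilde s=s$. For a real random variable $\tilde x$ on a finite probability space, $\mathrm{EVaR}_\alpha[\tilde x]=\sup_{\beta>0}\,-\frac1\beta\log\big(\alpha^{-1}\mathbb E[\exp(-\beta\tilde x)]\big)$ for $\alpha\in(0,1]$ (so $\mathrm{EVaR}_1[\tilde x]=\mathbb E[\tilde x]$), and $\mathrm{EVaR}_0[\tilde x]=\operatorname{ess\,inf}[\tilde x]$. The convention $0\log 0=0$ is used. *)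

theory Defs
  imports "HOL-Probability.Probability"
begin

record ('s, 'a) mdp =
  states :: "'s set"
  actions :: "'a set"
  trans :: "'s \<Rightarrow> 'a \<Rightarrow> 's pmf"
  reward :: "'s \<Rightarrow> 'a \<Rightarrow> 's \<Rightarrow> real"
  init :: "'s pmf"

text \<open>
  A probability distribution on the finite state set is a PMF whose support lies in that set.
  The last equation says both that the initial distribution lives on the state set and that it
  charges every state.
\<close>

definition finite_mdp :: "('s, 'a) mdp \<Rightarrow> bool" where
  "finite_mdp M \<longleftrightarrow>
     finite (states M) \<and> finite (actions M) \<and>
     (\<forall>s\<in>states M. \<forall>a\<in>actions M. set_pmf (trans M s a) \<subseteq> states M) \<and>
     set_pmf (init M) = states M"

definition step_pmf :: "('s, 'a) mdp \<Rightarrow> 'a \<Rightarrow> ('s \<times> 's) pmf" where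
  "step_pmf M a = do { s \<leftarrow> init M; s' \<leftarrow> trans M s a; return_pmf (s, s') }"

definition ess_inf :: "'b pmf \<Rightarrow> ('b \<Rightarrow> real) \<Rightarrow> real" where
  "ess_inf D X = Sup {c. AE \<omega> in measure_pmf D. c \<le> X \<omega>}"

text \<open>
  Meant for \<open>D\<close> of finite support and \<open>\<alpha> \<in> {0..1}\<close>, where both suprema are over nonempty sets
  that are bounded above; outside this range the value has no meaning.
\<close>

definition EVaR :: "real \<Rightarrow> 'b pmf \<Rightarrow> ('b \<Rightarrow> real) \<Rightarrow> real" where
  "EVaR \<alpha> D X =
     (if \<alpha> = 0 then ess_inf D X
      else SUP \<beta>\<in>{0<..}. - (1 / \<beta>) *
             ln (inverse \<alpha> * measure_pmf.expectation D (\<lambda>\<omega>. exp (- \<beta> * X \<omega>))))"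

definition prob_vectors :: "'s set \<Rightarrow> ('s \<Rightarrow> real) set" where
  "prob_vectors S = {\<xi> \<in> S \<rightarrow>\<^sub>E {0..}. (\<Sum>s\<in>S. \<xi> s) = 1}"

text \<open>The convention \<open>0 log 0 = 0\<close> holds because a product with factor \<open>0\<close> is \<open>0\<close>.\<close>

definition Z_E :: "('s, 'a) mdp \<Rightarrow> real \<Rightarrow> ('s \<Rightarrow> real) set" where
  "Z_E M \<alpha> =
     {\<xi> \<in> prob_vectors (states M).
        (\<Sum>s\<in>states M. \<xi> s * ln (\<xi> s / pmf (init M) s)) \<le> - ln \<alpha> \<and>
        (\<forall>s\<in>states M. \<alpha> * \<xi> s \<le> pmf (init M) s)}"

definition decomposition_objective ::
  "('s, 'a) mdp \<Rightarrow> 'a \<Rightarrow> real \<Rightarrow> ('s \<Rightarrow> real) \<Rightarrow> real" where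
  "decomposition_objective M a \<alpha> \<xi> =
     (\<Sum>s\<in>states M. \<xi> s *
        EVaR (\<alpha> * \<xi> s * inverse (pmf (init M) s))
          (cond_pmf (step_pmf M a) {\<omega>. fst \<omega> = s})
          (\<lambda>(_, s'). reward M s a s'))"

end

theory Submission
  imports Defs
begin

text \<open>
  The dual form of \<open>EVaR\<close> explains the gap: \<open>EVaR\<^sub>\<alpha>[X]\<close> is the smallest mean of \<open>X\<close> under a
  distribution \<open>Q\<close> with relative entropy at most \<open>- ln \<alpha>\<close>. By the chain rule this entropy budget
  is split between the marginal \<open>\<xi>\<close> of the initial state and the \<open>\<xi>\<close>-average of the entropies of
  the conditional laws, so an optimal \<open>Q\<close> may move budget from one state to another. The
  decomposition instead gives every state \<open>s\<close> its own budget \<open>- ln (\<alpha> \<xi>\<^sub>s / p\<^sub>s)\<close>, where \<open>p\<close> is the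
  initial distribution, and a state in which nothing is random wastes its share.

  The example has two equally likely states. State \<open>0\<close> always pays \<open>2\<close>; state \<open>1\<close> pays \<open>0\<close> or
  \<open>ln 2\<close> with equal probability. The payment \<open>2\<close> is so large that the decomposition never wants to
  visit state \<open>0\<close>: its minimum is attained at the vertex \<open>\<xi> = (0, 1)\<close>. The level \<open>\<alpha>\<close>, however,
  exceeds the probability \<open>1/4\<close> of the worst reward, and then the optimal \<open>Q\<close> is an exponential
  tilting of the original law. It charges state \<open>0\<close>, so its mean is strictly below every mean
  that the vertex can give.

  The risk level is chosen so that the supremum over \<open>\<beta>\<close> at the vertex is attained at \<open>\<beta> = 1\<close>.
  There the tilted law of state \<open>1\<close> is \<open>(2/3, 1/3)\<close>, with mean \<open>ln 2 / 3\<close> and relative entropy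
  \<open>5/3 ln 2 - ln 3\<close>, and this entropy has to be \<open>- ln (2 \<alpha>)\<close>. Lemma \<open>tilted_bound\<close> then gives the
  value \<open>ln 2 / 3\<close> at the vertex, lemma \<open>objective_lower_bound\<close> uses \<open>\<beta> = 1\<close> to show that no other
  \<open>\<xi>\<close> does better, and lemma \<open>EVaR_example_less\<close> bounds the left-hand side strictly below
  \<open>ln 2 / 3\<close>.
\<close>

declare One_nat_def [simp del]

section \<open>Bounds for the entropic value at risk\<close>

text \<open>At levels up to \<open>1\<close>, every upper bound of \<open>X\<close> bounds all terms of the supremum; this makes
  the supremum meaningful.\<close>

lemma entropic_term_le:
  fixes X :: "'b \<Rightarrow> real"
  assumes "finite (set_pmf D)" "0 < \<gamma>" "\<gamma> \<le> 1" "0 < \<beta>"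
    and le: "\<And>\<omega>. \<omega> \<in> set_pmf D \<Longrightarrow> X \<omega> \<le> c"
  shows "- (1 / \<beta>) * ln (inverse \<gamma> * measure_pmf.expectation D (\<lambda>\<omega>. exp (- \<beta> * X \<omega>))) \<le> c"
proof -
  let ?E = "measure_pmf.expectation D (\<lambda>\<omega>. exp (- \<beta> * X \<omega>))"
  have "exp (- \<beta> * c) = measure_pmf.expectation D (\<lambda>_. exp (- \<beta> * c))"
    by simp
  also have "\<dots> \<le> ?E"
    using assms by (intro integral_mono_AE integrable_measure_pmf_finite) (auto simp: AE_measure_pmf_iff)
  finally have E: "exp (- \<beta> * c) \<le> ?E" .
  have E0: "0 \<le> ?E"
    using less_le_trans[OF exp_gt_zero E] by simp
  have "?E \<le> inverse \<gamma> * ?E"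
    using mult_right_mono[OF _ E0, of 1 "inverse \<gamma>"] assms by (simp add: one_le_inverse)
  with E have "exp (- \<beta> * c) \<le> inverse \<gamma> * ?E"
    by simp
  then have "- \<beta> * c \<le> ln (inverse \<gamma> * ?E)"
    using ln_ge_iff less_le_trans exp_gt_zero by blast
  with \<open>0 < \<beta>\<close> show ?thesis
    by (simp add: field_simps)
qed

lemma entropic_term_le_EVaR:
  fixes X :: "'b \<Rightarrow> real"
  assumes fin: "finite (set_pmf D)" and "0 < \<gamma>" "\<gamma> \<le> 1" "0 < \<beta>"
  shows "- (1 / \<beta>) * ln (inverse \<gamma> * measure_pmf.expectation D (\<lambda>\<omega>. exp (- \<beta> * X \<omega>)))
    \<le> EVaR \<gamma> D X"
proof -
  have "X \<omega> \<le> Max (X ` set_pmf D)" if "\<omega> \<in> set_pmf D" for \<omega>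
    using that fin by simp
  then have "bdd_above ((\<lambda>\<beta>. - (1 / \<beta>) *
      ln (inverse \<gamma> * measure_pmf.expectation D (\<lambda>\<omega>. exp (- \<beta> * X \<omega>)))) ` {0<..})"
    using assms by (intro bdd_aboveI2[where M = "Max (X ` set_pmf D)"] entropic_term_le) auto
  from cSUP_upper[OF _ this, of \<beta>] show ?thesis
    using assms by (simp add: EVaR_def)
qed

lemma EVaR_le:
  assumes "\<gamma> \<noteq> 0"
    and "\<And>\<beta>. 0 < \<beta> \<Longrightarrow>
      - (1 / \<beta>) * ln (inverse \<gamma> * measure_pmf.expectation D (\<lambda>\<omega>. exp (- \<beta> * X \<omega>))) \<le> c"
  shows "EVaR \<gamma> D X \<le> c"
  unfolding EVaR_def using assms by (auto intro!: cSUP_least)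

text \<open>The term of \<open>\<beta>\<close> falls short of \<open>c\<close> by \<open>- ln \<gamma> / \<beta>\<close>, and this vanishes as \<open>\<beta>\<close> grows. At a
  level below \<open>1\<close> no single \<open>\<beta>\<close> suffices.\<close>

lemma EVaR_ge_const:
  assumes "0 < \<gamma>" "\<gamma> \<le> 1" "finite (set_pmf D)"
    and X: "\<And>\<omega>. \<omega> \<in> set_pmf D \<Longrightarrow> X \<omega> = c"
  shows "c \<le> EVaR \<gamma> D X"
proof (rule tendsto_upperbound)
  show "((\<lambda>\<beta>. c + ln \<gamma> / \<beta>) \<longlongrightarrow> c) at_top"
    using tendsto_add[OF tendsto_const tendsto_divide_0[OF tendsto_const
        filterlim_at_top_imp_at_infinity[OF filterlim_ident]]]
    by simp
  show "\<forall>\<^sub>F \<beta> in at_top. c + ln \<gamma> / \<beta> \<le> EVaR \<gamma> D X"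
    using eventually_gt_at_top[of 0]
  proof eventually_elim
    case (elim \<beta>)
    have "measure_pmf.expectation D (\<lambda>\<omega>. exp (- \<beta> * X \<omega>))
        = measure_pmf.expectation D (\<lambda>_. exp (- \<beta> * c))"
      using X by (intro integral_cong_AE) (auto simp: AE_measure_pmf_iff)
    then have "- (1 / \<beta>) * ln (inverse \<gamma> * exp (- \<beta> * c)) \<le> EVaR \<gamma> D X"
      using entropic_term_le_EVaR[of D \<gamma> \<beta> X] assms elim by simp
    moreover have "ln (inverse \<gamma> * exp (- \<beta> * c)) = - ln \<gamma> - \<beta> * c"
      using assms by (subst ln_mult) (auto simp: ln_inverse)
    ultimately show ?case
      using elim by (simp add: field_simps)
  qed
qed simp

section \<open>The example\<close>

definition example_mdp :: "(nat, nat) mdp" where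
  "example_mdp =
     \<lparr>states = {0, 1}, actions = {0}, trans = (\<lambda>_ _. pmf_of_set {0, 1}),
      reward = (\<lambda>s _ s'. if s = 0 then 2 else if s' = 0 then 0 else ln 2),
      init = pmf_of_set {0, 1}\<rparr>"

definition example_level :: real where
  "example_level = 3 / 2 * exp (- (5 / 3) * ln 2)"

lemma ln_example_level: "ln example_level = ln 3 - 8 / 3 * ln 2"
  by (simp add: example_level_def ln_mult ln_div)

lemma ln_3_less: "ln 3 < 5 / 3 * ln (2 :: real)"
proof -
  \<comment> \<open>This is \<open>3\<^sup>3 < 2\<^sup>5\<close>.\<close>
  have "ln ((3 :: real) ^ 3) < ln (2 ^ 5)"
    by (subst ln_less_cancel_iff) auto
  then have "3 * ln 3 < 5 * ln (2 :: real)"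
    by (simp only: ln_realpow of_nat_numeral)
  then show ?thesis
    by simp
qed

lemma example_level_pos: "0 < example_level"
  by (simp add: example_level_def)

lemma example_level_less: "example_level < 1 / 2"
proof -
  have "ln example_level < ln (1 / 2)"
    using ln_3_less by (simp add: ln_example_level ln_div)
  then show ?thesis
    using example_level_pos by simp
qed

lemma step_pmf_example: "step_pmf example_mdp 0 = pmf_of_set ({0, 1} \<times> {0, 1})"
proof (rule pmf_eqI)
  fix z :: "nat \<times> nat"
  have "step_pmf example_mdp 0 = pair_pmf (pmf_of_set {0, 1}) (pmf_of_set {0, 1})"
    by (simp add: step_pmf_def example_mdp_def pair_pmf_def)
  then show "pmf (step_pmf example_mdp 0) z = pmf (pmf_of_set ({0, 1} \<times> {0, 1})) z"
    by (cases z) (auto simp: pmf_pair indicator_def card_cartesian_product)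
qed

lemma cond_pmf_example:
  assumes "s \<in> {0, 1}"
  shows "cond_pmf (step_pmf example_mdp 0) {\<omega>. fst \<omega> = s} = pmf_of_set ({s} \<times> {0, 1})"
proof -
  let ?P = "pmf_of_set ({0, 1} \<times> {0, 1 :: nat})"
  have eq: "({0, 1} \<times> {0, 1}) \<inter> {\<omega>. fst \<omega> = s} = {s} \<times> {0, 1 :: nat}"
    using assms by auto
  then have "set_pmf ?P \<inter> {\<omega>. fst \<omega> = s} \<noteq> {}"
    by (subst set_pmf_of_set) auto
  moreover have "measure_pmf.prob ?P {\<omega>. fst \<omega> = s} = 1 / 2"
    by (subst measure_pmf_of_set) (simp_all only: eq, auto simp: card_cartesian_product)
  ultimately show ?thesis
    unfolding step_pmf_example using assms
    by (intro pmf_eqI) (auto simp: pmf_cond indicator_def card_cartesian_product)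
qed

lemma expectation_state_1:
  "measure_pmf.expectation (pmf_of_set ({1 :: nat} \<times> {0, 1 :: nat}))
     (\<lambda>\<omega>. exp (- \<beta> * (case \<omega> of (_, s') \<Rightarrow> reward example_mdp 1 0 s')))
   = (1 + exp (- \<beta> * ln 2)) / 2"
  by (subst integral_pmf_of_set) (auto simp: example_mdp_def)

lemma expectation_example:
  "measure_pmf.expectation (step_pmf example_mdp 0)
     (\<lambda>\<omega>. exp (- \<beta> * (case \<omega> of (s, s') \<Rightarrow> reward example_mdp s 0 s')))
   = (1 + exp (- \<beta> * ln 2) + 2 * exp (- 2 * \<beta>)) / 4"
  unfolding step_pmf_example
  by (subst integral_pmf_of_set) (auto simp: example_mdp_def field_simps)

lemma decomposition_objective_example:
  "decomposition_objective example_mdp 0 example_level \<xi> =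
     \<xi> 0 * EVaR (2 * example_level * \<xi> 0) (pmf_of_set ({0 :: nat} \<times> {0, 1 :: nat}))
       (\<lambda>(_, s'). reward example_mdp 0 0 s') +
     \<xi> 1 * EVaR (2 * example_level * \<xi> 1) (pmf_of_set ({1 :: nat} \<times> {0, 1 :: nat}))
       (\<lambda>(_, s'). reward example_mdp 1 0 s')"
proof -
  have "states example_mdp = {0, 1}" "pmf (init example_mdp) 0 = 1 / 2"
    "pmf (init example_mdp) 1 = 1 / 2"
    by (auto simp: example_mdp_def indicator_def)
  then have "states example_mdp = {0, 1}" "inverse (pmf (init example_mdp) 0) = 2"
    "inverse (pmf (init example_mdp) 1) = 2"
    by (simp_all only: inverse_eq_divide) simp_all
  then show ?thesis
    using cond_pmf_example[of 0] cond_pmf_example[of 1]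
    by (simp add: decomposition_objective_def mult_ac)
qed

section \<open>The minimum of the decomposition\<close>

text \<open>This is Gibbs' inequality for the tilted law \<open>(2/3, 1/3)\<close> of state \<open>1\<close>, with equality at
  \<open>\<beta> = 1\<close>. Written as a weighted mean of two exponentials with mean exponent \<open>0\<close>, the ratio of
  the exponentials of the right-hand and the left-hand side is at least \<open>1\<close> by \<open>exp x \<ge> 1 + x\<close>.\<close>

lemma tilted_bound:
  "ln 3 - 5 / 3 * ln 2 - \<beta> * ln 2 / 3 \<le> ln ((1 + exp (- \<beta> * ln 2)) / (2 :: real))"
proof -
  define K where "K = ln 3 - 5 / 3 * ln 2 - \<beta> * ln 2 / (3 :: real)"
  \<comment> \<open>The logarithms of \<open>3/4\<close> and \<open>3/2 exp (- \<beta> ln 2)\<close> are recentred by their mean \<open>K\<close> under the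
    tilted law; the weights \<open>2/3\<close> and \<open>1/3\<close> turn these two numbers into the summands on the right.\<close>
  define a where "a = ln 3 - 2 * ln 2 - K"
  define b where "b = ln 3 - ln 2 - \<beta> * ln 2 - K"
  have "2 * a + b = 0"
    by (simp add: a_def b_def K_def field_simps)
  with exp_ge_add_one_self[of a] exp_ge_add_one_self[of b]
  have "1 \<le> 2 / 3 * exp a + 1 / 3 * exp b"
    by linarith
  then have "exp K * 1 \<le> exp K * (2 / 3 * exp a + 1 / 3 * exp b)"
    by (rule mult_left_mono) simp
  also have "\<dots> = 2 / 3 * exp (K + a) + 1 / 3 * exp (K + b)"
    by (simp add: exp_add distrib_left)
  also have "\<dots> = 2 / 3 * exp (ln 3 - 2 * ln 2) + 1 / 3 * exp (ln 3 - ln 2 - \<beta> * ln 2)"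
    by (simp add: a_def b_def)
  also have "2 * ln 2 = ln (4 :: real)"
    using ln_realpow[of 2 2] by simp
  also have "2 / 3 * exp (ln 3 - ln 4) + 1 / 3 * exp (ln 3 - ln 2 - \<beta> * ln 2)
      = (1 + exp (- \<beta> * ln 2)) / 2"
    by (simp add: exp_diff exp_add exp_minus field_simps)
  finally show ?thesis
    unfolding K_def by (subst ln_ge_iff) (auto intro: add_pos_pos)
qed

text \<open>State \<open>1\<close> contributes at least its term at \<open>\<beta> = 1\<close>, and state \<open>0\<close> contributes at least its
  constant reward times its weight. Since \<open>t ln t \<ge> t - 1\<close>, leaving the vertex saves at most
  \<open>1 + ln 2 / 3\<close> per unit of mass, which is less than the reward \<open>2\<close> paid in state \<open>0\<close>.\<close>

lemma objective_lower_bound: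
  assumes \<xi>: "\<xi> \<in> Z_E example_mdp example_level"
  shows "ln 2 / 3 \<le> decomposition_objective example_mdp 0 example_level \<xi>"
proof -
  let ?t = "\<xi> 1"
  let ?V0 = "EVaR (2 * example_level * \<xi> 0) (pmf_of_set ({0 :: nat} \<times> {0, 1 :: nat}))
    (\<lambda>(_, s'). reward example_mdp 0 0 s')"
  let ?V1 = "EVaR (2 * example_level * ?t) (pmf_of_set ({1 :: nat} \<times> {0, 1 :: nat}))
    (\<lambda>(_, s'). reward example_mdp 1 0 s')"
  have nn: "0 \<le> \<xi> 0" "0 \<le> ?t" and s: "\<xi> 0 = 1 - ?t"
    and lev: "2 * example_level * \<xi> 0 \<le> 1" "2 * example_level * ?t \<le> 1"
    using \<xi> by (auto simp: Z_E_def prob_vectors_def example_mdp_def PiE_iff indicator_def)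
  have V0: "2 * \<xi> 0 \<le> \<xi> 0 * ?V0"
  proof (cases "\<xi> 0 = 0")
    case False
    then have "2 \<le> ?V0"
      using nn lev example_level_pos by (intro EVaR_ge_const) (auto simp: example_mdp_def)
    then show ?thesis
      using nn mult_left_mono[of 2 ?V0 "\<xi> 0"] by simp
  qed simp
  have V1: "?t - 1 + ?t * (ln 2 / 3) \<le> ?t * ?V1"
  proof (cases "?t = 0")
    case False
    with nn have t: "0 < ?t" by simp
    have "- (1 / 1) * ln (inverse (2 * example_level * ?t) * ((1 + exp (- 1 * ln 2)) / 2)) \<le> ?V1"
      unfolding expectation_state_1[symmetric]
      using lev t example_level_pos by (intro entropic_term_le_EVaR) auto
    moreover have "(1 + exp (- 1 * ln 2)) / 2 = (3 :: real) / 2 ^ 2"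
      by (simp add: exp_minus)
    moreover have "ln (inverse (2 * example_level * ?t) * (3 / 2 ^ 2)) = - (ln 2 / 3) - ln ?t"
      using t example_level_pos
      by (simp only: ln_mult ln_div ln_inverse ln_realpow ln_example_level inverse_mult_distrib)
        (simp add: ln_mult ln_div ln_inverse ln_realpow ln_example_level field_simps)
    ultimately have "- 1 * (- (ln 2 / 3) - ln ?t) \<le> ?V1"
      by (simp only: div_by_1)
    then have "ln 2 / 3 + ln ?t \<le> ?V1"
      by simp
    moreover have "1 - inverse ?t \<le> ln ?t"
      using ln_le_minus_one[of "inverse ?t"] t by (simp add: ln_inverse)
    ultimately have "ln 2 / 3 + 1 - inverse ?t \<le> ?V1"
      by simp
    then have "?t * (ln 2 / 3 + 1 - inverse ?t) \<le> ?t * ?V1"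
      using t by (intro mult_left_mono) auto
    then show ?thesis
      using t by (simp add: algebra_simps)
  qed simp
  have "ln (2 :: real) \<le> 1"
    using ln_le_minus_one[of "2 :: real"] by simp
  then have "(1 - ?t) * (ln 2 / 3) \<le> (1 - ?t) * 1"
    using nn s by (intro mult_left_mono) auto
  then have "ln 2 / 3 \<le> 1 - ?t + ?t * (ln 2 / 3)"
    by (simp add: left_diff_distrib)
  with V0 V1 s show ?thesis
    unfolding decomposition_objective_example by linarith
qed

definition vertex :: "nat \<Rightarrow> real" where
  "vertex = (\<lambda>s\<in>{0, 1}. if s = 1 then 1 else 0)"

lemma vertex_in_Z_E: "vertex \<in> Z_E example_mdp example_level"
  using example_level_less example_level_pos ln_3_less
  by (auto simp: Z_E_def prob_vectors_def example_mdp_def vertex_def indicator_def ln_example_level)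

text \<open>Every term of the supremum is at most the mean of the tilted law, by Gibbs' inequality.\<close>

lemma state_1_term_le:
  assumes "0 < \<beta>"
  shows "- (1 / \<beta>) * ln (inverse (2 * example_level) * ((1 + exp (- \<beta> * ln 2)) / 2)) \<le> ln 2 / 3"
proof -
  have "0 < (1 + exp (- \<beta> * ln 2)) / (2 :: real)"
    by (auto intro: add_pos_pos)
  moreover have "ln (inverse (2 * example_level)) = 5 / 3 * ln 2 - ln 3"
    using example_level_pos ln_inverse[of "2 * example_level"]
    by (simp add: ln_mult ln_example_level del: inverse_mult_distrib)
  ultimately have "ln (inverse (2 * example_level) * ((1 + exp (- \<beta> * ln 2)) / 2))
      = 5 / 3 * ln 2 - ln 3 + ln ((1 + exp (- \<beta> * ln 2)) / 2)"
    using example_level_pos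
    by (subst ln_mult) auto
  with tilted_bound[of \<beta>] have "- (\<beta> * ln 2 / 3)
      \<le> ln (inverse (2 * example_level) * ((1 + exp (- \<beta> * ln 2)) / 2))"
    by linarith
  with assms show ?thesis
    by (simp add: field_simps)
qed

lemma objective_vertex: "decomposition_objective example_mdp 0 example_level vertex = ln 2 / 3"
proof (rule antisym)
  have "EVaR (2 * example_level) (pmf_of_set ({1 :: nat} \<times> {0, 1 :: nat}))
      (\<lambda>(_, s'). reward example_mdp 1 0 s') \<le> ln 2 / 3"
    using example_level_pos state_1_term_le
    by (intro EVaR_le) (simp, simp only: expectation_state_1)
  then show "decomposition_objective example_mdp 0 example_level vertex \<le> ln 2 / 3"
    unfolding decomposition_objective_example by (simp add: vertex_def)
qed (rule objective_lower_bound[OF vertex_in_Z_E])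

section \<open>The gap\<close>

text \<open>Compared with the supremum at the vertex, each term contains the extra mass
  \<open>exp (- 2 \<beta>)\<close> from state \<open>0\<close>. For \<open>\<beta> \<le> 3\<close> this mass lowers the term by a fixed amount. For
  \<open>\<beta> \<ge> 3\<close> the term is small by itself: the minimal reward \<open>0\<close> has probability \<open>1/4\<close>, so the term is
  at most \<open>ln (4 \<alpha>) / \<beta>\<close>, and since \<open>4 \<alpha> < 2\<close> this is below \<open>ln 2 / 3\<close> from \<open>\<beta> = 3\<close> on.\<close>

lemma EVaR_example_less:
  "EVaR example_level (step_pmf example_mdp 0) (\<lambda>(s, s'). reward example_mdp s 0 s') < ln 2 / 3"
proof -
  let ?\<alpha> = example_level
  define B where "B = max (ln (4 * ?\<alpha>) / 3) (ln 2 / 3 - ln (1 + exp (- 6)) / 3)"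
  have \<alpha>: "0 < ?\<alpha>" "4 * ?\<alpha> < 2"
    using example_level_pos example_level_less by auto
  have "ln (4 * ?\<alpha>) < ln 2"
    using \<alpha> by simp
  moreover have pos: "0 < ln (4 * ?\<alpha>)"
  proof -
    have "ln ((2 :: real) ^ 2) < ln (3 ^ 3)"
      by (subst ln_less_cancel_iff) auto
    then have "2 * ln 2 < 3 * ln (3 :: real)"
      by (simp only: ln_realpow of_nat_numeral)
    moreover have "ln (4 * ?\<alpha>) = ln 3 - 2 / 3 * ln 2"
      using \<alpha> ln_realpow[of 2 2] by (simp add: ln_mult ln_example_level)
    ultimately show ?thesis
      by simp
  qed
  moreover have "0 < ln (1 + exp (- 6 :: real))"
    by (intro ln_gt_zero) simp
  ultimately have "B < ln 2 / 3"
    unfolding B_def max_less_iff_conj by linarith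
  moreover have "EVaR ?\<alpha> (step_pmf example_mdp 0) (\<lambda>(s, s'). reward example_mdp s 0 s') \<le> B"
  proof (rule EVaR_le, use \<alpha> in simp, unfold expectation_example)
    fix \<beta> :: real
    assume \<beta>: "0 < \<beta>"
    define E where "E = (1 + exp (- \<beta> * ln 2)) / (2 :: real)"
    have E: "1 / 2 < E" "E \<le> 1"
      using \<beta> by (auto simp: E_def)
    let ?L = "ln (inverse ?\<alpha> * ((1 + exp (- \<beta> * ln 2) + 2 * exp (- 2 * \<beta>)) / 4))"
    show "- (1 / \<beta>) * ?L \<le> B"
    proof (cases "\<beta> \<le> 3")
      case True
      have "exp (- 6) \<le> exp (- 2 * \<beta>)"
        using True by simp
      moreover have "E * exp (- 6) \<le> 1 * exp (- 6)"
        using E by (intro mult_right_mono) auto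
      ultimately have "E * (1 + exp (- 6)) \<le> E + exp (- 2 * \<beta>)"
        unfolding distrib_left by linarith
      then have "inverse (2 * ?\<alpha>) * (E * (1 + exp (- 6))) \<le> inverse (2 * ?\<alpha>) * (E + exp (- 2 * \<beta>))"
        using \<alpha> by (intro mult_left_mono) auto
      also have "\<dots> = inverse ?\<alpha> * ((1 + exp (- \<beta> * ln 2) + 2 * exp (- 2 * \<beta>)) / 4)"
        using \<alpha> by (simp add: E_def field_simps)
      finally have "ln ((inverse (2 * ?\<alpha>) * E) * (1 + exp (- 6))) \<le> ?L"
        using \<alpha> E by (intro ln_mono) (auto simp: mult.assoc intro!: mult_pos_pos add_pos_pos)
      moreover have "ln ((inverse (2 * ?\<alpha>) * E) * (1 + exp (- 6)))
          = ln (inverse (2 * ?\<alpha>) * E) + ln (1 + exp (- 6))"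
        using \<alpha> E by (intro ln_mult_pos) (auto intro!: mult_pos_pos add_pos_pos)
      ultimately have "ln (inverse (2 * ?\<alpha>) * E) + ln (1 + exp (- 6)) \<le> ?L"
        by simp
      then have "- (1 / \<beta>) * ?L \<le> - (1 / \<beta>) * (ln (inverse (2 * ?\<alpha>) * E) + ln (1 + exp (- 6)))"
        using \<beta> by (intro mult_left_mono_neg) auto
      also have "\<dots> = - (1 / \<beta>) * ln (inverse (2 * ?\<alpha>) * E) - ln (1 + exp (- 6)) / \<beta>"
        by (simp add: algebra_simps add_divide_distrib)
      also have "\<dots> \<le> ln 2 / 3 - ln (1 + exp (- 6)) / 3"
        using state_1_term_le[OF \<beta>] \<beta> True
        by (intro diff_mono divide_left_mono) (auto simp: E_def)
      finally show ?thesis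
        by (simp add: B_def)
    next
      case False
      have "inverse (4 * ?\<alpha>) \<le> inverse ?\<alpha> * ((1 + exp (- \<beta> * ln 2) + 2 * exp (- 2 * \<beta>)) / 4)"
        using \<alpha> by (simp add: field_simps)
      then have "ln (inverse (4 * ?\<alpha>)) \<le> ?L"
        using \<alpha> by (intro ln_mono) (auto intro!: mult_pos_pos add_pos_pos)
      then have "- ln (4 * ?\<alpha>) \<le> ?L"
        using \<alpha> by (simp only: ln_inverse)
      then have "- (1 / \<beta>) * ?L \<le> ln (4 * ?\<alpha>) / \<beta>"
        using \<beta> by (simp add: field_simps)
      also have "\<dots> \<le> ln (4 * ?\<alpha>) / 3"
        using False pos by (intro divide_left_mono) auto
      finally show ?thesis
        unfolding B_def by (rule max.coboundedI1)
    qed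
  qed
  ultimately show ?thesis
    by simp
qed

theorem theorem4p1:
  shows "\<exists>(M :: (nat, nat) mdp) a\<^sub>1 \<alpha>.
    finite_mdp M \<and> actions M = {a\<^sub>1} \<and> 0 < \<alpha> \<and> \<alpha> \<le> 1 \<and>
    (\<exists>\<xi>. is_arg_min (decomposition_objective M a\<^sub>1 \<alpha>) (\<lambda>\<xi>. \<xi> \<in> Z_E M \<alpha>) \<xi> \<and>
         EVaR \<alpha> (step_pmf M a\<^sub>1) (\<lambda>(s, s'). reward M s a\<^sub>1 s')
           < decomposition_objective M a\<^sub>1 \<alpha> \<xi>)"
proof (intro exI conjI)
  show "finite_mdp example_mdp" "actions example_mdp = {0}"
    by (auto simp: finite_mdp_def example_mdp_def)
  show "0 < example_level" "example_level \<le> 1"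
    using example_level_pos example_level_less by auto
  show "is_arg_min (decomposition_objective example_mdp 0 example_level)
      (\<lambda>\<xi>. \<xi> \<in> Z_E example_mdp example_level) vertex"
    using objective_lower_bound vertex_in_Z_E
    by (auto simp: is_arg_min_linorder objective_vertex)
  show "EVaR example_level (step_pmf example_mdp 0) (\<lambda>(s, s'). reward example_mdp s 0 s')
      < decomposition_objective example_mdp 0 example_level vertex"
    using EVaR_example_less by (simp add: objective_vertex)
qed

end
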